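(* For every fixed integer $r>0$ there are infinitely many numerical semigroups of minimal reduced type with type $r$; that is, infinitely many numerical semigroups $S$ with $\mathrm{type}(k[[S]])=r$ such that $k[[S]]$ has minimal reduced type.
   Context: $\mathbb{N}$ denotes the non-negative integers. A numerical semigroup is a submonoid $S$ of $(\mathbb{N},+)$ with $\mathbb{N}\setminus S$ finite. The multiplicity $m(S)$ is the smallest nonzero element of $S$, and the Frobenius number $\mathrm{F}(S)$ is the largest integer not in $S$. A pseudo-Frobenius number of $S$ is an integer $f\notin S$ with $f+s\in S$ for all $s\in S\setminus\{0\}$; $\mathrm{PF}(S)$ is the set of these. Let $k$ be an algebraically closed field of characteristic zero. For $S$ with minimal generators $n_1,\ldots,n_e$, $R=k[[S]] := k[[t^{n_1},\ldots,t^{n_e}]]\subseteq k[[t]]$. The type, $\mathrm{type}(k[[S]])$, is the Cohen-Macaulay type of $k[[S]]$, which equals $|\mathrm{PF}(S)|$. With $K$ the quotient field of $R$, $\bar R$ its integral closure in $K$ and $\mathfrak{C}=(R:_K\bar R)$ the conductor ideal, the reduced type is $s(R)=\dim_k \frac{\mathfrak{C}+xR}{xR}$ with $x=t^{m(S)}$; it satisfies $1\le s(R)\le \mathrm{type}(R)$, and it is known to equal the number of integers in $[\mathrm{F}(S)-m(S)+1,\mathrm{F}(S)]\setminus S$. $R$ (or $S$) has minimal reduced type if $s(R)=1$. *)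

theory Defs
  imports "HOL-Computational_Algebra.Computational_Algebra"
begin

section \<open>Numerical semigroups\<close>

definition numerical_semigroup :: "nat set \<Rightarrow> bool" where
  "numerical_semigroup S \<longleftrightarrow>
     0 \<in> S \<and> (\<forall>a\<in>S. \<forall>b\<in>S. a + b \<in> S) \<and> finite (UNIV - S)"

definition multiplicity_sg :: "nat set \<Rightarrow> nat" where
  "multiplicity_sg S = (LEAST n. n \<in> S \<and> n \<noteq> 0)"

definition min_gens :: "nat set \<Rightarrow> nat set" where
  "min_gens S = {n \<in> S - {0}. \<not> (\<exists>a \<in> S - {0}. \<exists>b \<in> S - {0}. n = a + b)}"


section \<open>The semigroup ring\<close>

text \<open>
  The ring \<open>k[[t^n : n \<in> G]]\<close>, for a finite set \<open>G\<close> of positive exponents, is the image of the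
  formal power series ring in variables \<open>x\<^sub>n\<close> (\<open>n \<in> G\<close>) under the substitution of \<open>t^n\<close> for \<open>x\<^sub>n\<close>.
  Such a series is given by its family \<open>c\<close> of coefficients, indexed by the exponent vectors
  \<open>a :: nat \<Rightarrow> nat\<close> supported on \<open>G\<close>; only finitely many of these contribute to each power of \<open>t\<close>.
\<close>

definition fps_subst_powers :: "nat set \<Rightarrow> ((nat \<Rightarrow> nat) \<Rightarrow> 'k::field) \<Rightarrow> 'k fps" where
  "fps_subst_powers G c =
     Abs_fps (\<lambda>n. \<Sum>a | (\<forall>g. g \<notin> G \<longrightarrow> a g = 0) \<and> (\<Sum>g\<in>G. a g * g) = n. c a)"

text \<open>All rings below are subrings of the field \<open>k((t))\<close> of formal Laurent series.\<close>

definition semigroup_ring :: "nat set \<Rightarrow> 'k::field fls set" where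
  "semigroup_ring S = fps_to_fls ` range (fps_subst_powers (min_gens S))"


section \<open>Subrings of a field\<close>

definition quotient_field :: "'a::field set \<Rightarrow> 'a set" where
  "quotient_field R = {a / b | a b. a \<in> R \<and> b \<in> R \<and> b \<noteq> 0}"

definition integral_closure :: "'a::field set \<Rightarrow> 'a set \<Rightarrow> 'a set" where
  "integral_closure R K =
     {z \<in> K. \<exists>p. lead_coeff p = 1 \<and> (\<forall>i. coeff p i \<in> R) \<and> poly p z = 0}"

definition conductor :: "'a::field set \<Rightarrow> 'a set" where
  "conductor R =
     (let K = quotient_field R
      in {z \<in> K. \<forall>y \<in> integral_closure R K. z * y \<in> R})"

definition principal_ideal :: "'a::field set \<Rightarrow> 'a \<Rightarrow> 'a set" where
  "principal_ideal R x = {x * a | a. a \<in> R}"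

text \<open>The set of non-units, which is the maximal ideal when \<open>R\<close> is local.\<close>

definition maximal_ideal_of :: "'a::field set \<Rightarrow> 'a set" where
  "maximal_ideal_of R = {x \<in> R. \<not> (\<exists>y \<in> R. x * y = 1)}"


section \<open>Dimension of a quotient of vector spaces\<close>

text \<open>
  For \<open>k\<close>-subspaces \<open>W \<subseteq> V\<close> of \<open>k((t))\<close>: the cosets \<open>b + W\<close>, \<open>b \<in> B\<close>, are pairwise distinct and
  form a basis of \<open>V / W\<close>, that is, every coset is a unique finite linear combination of them.
\<close>

definition basis_modulo :: "'k::field fls set \<Rightarrow> 'k fls set \<Rightarrow> 'k fls set \<Rightarrow> bool" where
  "basis_modulo V W B \<longleftrightarrow>
     B \<subseteq> V \<and>
     (\<forall>v\<in>V. \<exists>!c. finite {b. c b \<noteq> 0} \<and> {b. c b \<noteq> 0} \<subseteq> B \<and>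
        v - (\<Sum>b | c b \<noteq> 0. fls_const (c b) * b) \<in> W)"

text \<open>As for the library's \<open>dim\<close>, the value is \<open>0\<close> in the infinite-dimensional case.\<close>

definition quotient_dim :: "'k::field fls set \<Rightarrow> 'k fls set \<Rightarrow> nat" where
  "quotient_dim V W = card (SOME B. basis_modulo V W B)"


section \<open>Cohen-Macaulay type and reduced type\<close>

text \<open>
  \<open>socle_preimage R x / x R\<close> is the socle of \<open>R / x R\<close>, the annihilator of the maximal ideal.
\<close>

definition socle_preimage :: "'k::field fls set \<Rightarrow> 'k fls \<Rightarrow> 'k fls set" where
  "socle_preimage R x =
     {z \<in> R. \<forall>y \<in> maximal_ideal_of R. y * z \<in> principal_ideal R x}"

text \<open>
  The type of a Cohen-Macaulay local ring is the dimension over the residue field of the socle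
  modulo a maximal regular sequence, and does not depend on that sequence. The definition is for
  one-dimensional local domains, where any nonzero non-unit \<open>x\<close> is a maximal regular sequence, with
  residue field \<open>k\<close>, such as \<open>k[[S]]\<close>.
\<close>

definition cm_type :: "'k::field fls set \<Rightarrow> nat" where
  "cm_type R =
     (let x = (SOME x. x \<in> maximal_ideal_of R \<and> x \<noteq> 0)
      in quotient_dim (socle_preimage R x) (principal_ideal R x))"

text \<open>The type argument selects the coefficient field \<open>k\<close>.\<close>

definition reduced_type :: "'k::field itself \<Rightarrow> nat set \<Rightarrow> nat" where
  "reduced_type _ S =
     (let R = semigroup_ring S :: 'k fls set;
          x = fls_X ^ multiplicity_sg S
      in quotient_dim {c + y | c y. c \<in> conductor R \<and> y \<in> principal_ideal R x}
                      (principal_ideal R x))"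

definition minimal_reduced_type :: "'k::field itself \<Rightarrow> nat set \<Rightarrow> bool" where
  "minimal_reduced_type k S \<longleftrightarrow> reduced_type k S = 1"

end

theory Submission
  imports Defs
begin

text \<open>
  Both invariants can be read off from the gaps of \<open>S\<close>. The ring \<open>R = k[[S]]\<close> consists of all series
  with support in \<open>S\<close>, and the modules that define the invariants are again spaces of series with
  prescribed support, up to multiplication by one fixed series. The dimension of a quotient of two
  such spaces is the number of exponents by which their supports differ
  (\<open>quotient_dim_supported_on\<close>). Thus the type is the number of pseudo-Frobenius numbers
  (\<open>cm_type_semigroup_ring\<close>), because \<open>(R : \<mm>)\<close> has support \<open>S \<union> PF(S)\<close>, and the reduced type
  is the number of gaps among the \<open>m(S)\<close> consecutive integers ending at the Frobenius number
  (\<open>reduced_type_eq_card_gaps\<close>), because the conductor consists of the series with all exponents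
  beyond the Frobenius number \<open>F\<close>.

  It remains to find infinitely many semigroups with \<open>r\<close> pseudo-Frobenius numbers and only one gap
  in that window. Put \<open>m = r + 1\<close>, let \<open>c > 0\<close> be a multiple of \<open>m\<close>, and take the multiples of \<open>m\<close>
  together with all integers beyond \<open>c + m\<close> except \<open>F = c + m + r\<close>. The last window is
  \<open>[c + m, c + m + r]\<close> and contains only the gap \<open>F\<close>; the pseudo-Frobenius numbers are
  \<open>c + 1, \<dots>, c + r - 1\<close> and \<open>F\<close>.
\<close>

section \<open>Dimension of a quotient as the rank of a linear map\<close>

unbundle fps_syntax
notation fls_nth (infixl \<open>$$\<close> 75)

abbreviation fls_scale :: "'k::field \<Rightarrow> 'k fls \<Rightarrow> 'k fls" where
  "fls_scale c f \<equiv> fls_const c * f"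

global_interpretation fls: vector_space "fls_scale :: 'k::field \<Rightarrow> 'k fls \<Rightarrow> 'k fls"
  by unfold_locales (simp_all add: algebra_simps flip: fls_plus_const)

abbreviation fls_linear :: "('k::field fls \<Rightarrow> 'k fls) \<Rightarrow> bool" where
  "fls_linear \<equiv> Vector_Spaces.linear fls_scale fls_scale"

text \<open>
  Expanding \<open>v\<close> in \<open>B\<close> modulo \<open>W = V \<inter> ker p\<close> is the same as expanding \<open>p v\<close> in the family \<open>p b\<close>,
  \<open>b \<in> B\<close>. So existence of expansions says that this family spans \<open>p ` V\<close>, and uniqueness that it
  is independent, with no repetitions.
\<close>

lemma basis_modulo_kernel_iff:
  fixes p :: "'k::field fls \<Rightarrow> 'k fls"
  assumes lin: "fls_linear p" and V: "fls.subspace V" and W: "W = {v \<in> V. p v = 0}" and B: "B \<subseteq> V"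
  shows "basis_modulo V W B \<longleftrightarrow>
    inj_on p B \<and> fls.independent (p ` B) \<and> p ` V \<subseteq> fls.span (p ` B)"
proof -
  interpret p: Vector_Spaces.linear fls_scale fls_scale p by (rule lin)
  define coords where "coords v c \<longleftrightarrow>
    finite {b. c b \<noteq> 0} \<and> {b. c b \<noteq> 0} \<subseteq> B \<and> p v = (\<Sum>b | c b \<noteq> 0. fls_scale (c b) (p b))" for v c
  have sum_supp: "(\<Sum>b | c b \<noteq> 0. fls_scale (c b) (p b)) = (\<Sum>b\<in>T. fls_scale (c b) (p b))"
    if "finite T" "{b. c b \<noteq> 0} \<subseteq> T" for c :: "'k fls \<Rightarrow> 'k" and T
    using that by (intro sum.mono_neutral_left) auto
  have basis_iff: "basis_modulo V W B \<longleftrightarrow> (\<forall>v\<in>V. \<exists>!c. coords v c)"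
  proof -
    have "v - (\<Sum>b | c b \<noteq> 0. fls_scale (c b) b) \<in> W \<longleftrightarrow>
        p v = (\<Sum>b | c b \<noteq> 0. fls_scale (c b) (p b))"
      if "v \<in> V" "{b. c b \<noteq> 0} \<subseteq> B" for v c
    proof -
      have "(\<Sum>b | c b \<noteq> 0. fls_scale (c b) b) \<in> V"
        using that B by (intro fls.subspace_sum[OF V] fls.subspace_scale[OF V]) auto
      then have "v - (\<Sum>b | c b \<noteq> 0. fls_scale (c b) b) \<in> V"
        by (intro fls.subspace_diff[OF V] that)
      then show ?thesis
        by (simp add: W p.diff p.sum p.scale)
    qed
    then have "(finite {b. c b \<noteq> 0} \<and> {b. c b \<noteq> 0} \<subseteq> B \<and>
        v - (\<Sum>b | c b \<noteq> 0. fls_scale (c b) b) \<in> W) \<longleftrightarrow> coords v c" if "v \<in> V" for v c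
      unfolding coords_def using that by blast
    then show ?thesis
      using B unfolding basis_modulo_def by simp
  qed
  show ?thesis
  proof
    assume "basis_modulo V W B"
    then have ex1: "\<exists>!c. coords v c" if "v \<in> V" for v
      using basis_iff that by blast
    have inj: "inj_on p B"
    proof (rule inj_onI)
      fix a b assume ab: "a \<in> B" "b \<in> B" "p a = p b"
      \<comment> \<open>If \<open>p a = p b\<close>, then both indicator functions expand \<open>a\<close>.\<close>
      define e where "e x y = (if y = x then 1 else 0 :: 'k)" for x y :: "'k fls"
      have supp: "{y. e x y \<noteq> 0} = {x}" for x by (auto simp: e_def)
      have "coords a (e a)" "coords a (e b)"
        using ab unfolding coords_def supp by (auto simp: e_def)
      then have "e a = e b"
        using ex1 ab B by blast
      then have "e a a = e b a" by simp
      then show "a = b" by (simp add: e_def split: if_splits)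
    qed
    moreover have "fls.independent (p ` B)"
      unfolding fls.independent_explicit_module
    proof (intro allI impI)
      fix t u y
      assume t: "finite t" "t \<subseteq> p ` B" and sum0: "(\<Sum>x\<in>t. fls_scale (u x) x) = 0" and y: "y \<in> t"
      obtain T where T: "T \<subseteq> B" "t = p ` T"
        using t(2) by (meson subset_imageE)
      have injT: "inj_on p T" using inj T(1) by (rule inj_on_subset)
      then have finT: "finite T" using t(1) T(2) by (simp add: finite_image_iff)
      define c where "c b = (if b \<in> T then u (p b) else 0)" for b
      have supp: "{b. c b \<noteq> 0} \<subseteq> T" by (auto simp: c_def)
      have "(\<Sum>b\<in>T. fls_scale (c b) (p b)) = 0"
        using sum0 unfolding T(2) sum.reindex[OF injT] by (simp add: c_def)
      then have "coords 0 c"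
        unfolding coords_def sum_supp[OF finT supp] using supp T(1) finT
        by (auto intro: finite_subset)
      moreover have "coords 0 (\<lambda>_. 0)"
        by (simp add: coords_def)
      ultimately have "c = (\<lambda>_. 0)"
        using ex1[of 0] fls.subspace_0[OF V] by blast
      moreover obtain b where "b \<in> T" "y = p b" using y T(2) by auto
      ultimately show "u y = 0"
        using c_def[of b] by simp
    qed
    moreover have "p ` V \<subseteq> fls.span (p ` B)"
    proof (rule image_subsetI)
      fix v assume "v \<in> V"
      then obtain c where c: "{b. c b \<noteq> 0} \<subseteq> B" "p v = (\<Sum>b | c b \<noteq> 0. fls_scale (c b) (p b))"
        using ex1 unfolding coords_def by blast
      show "p v \<in> fls.span (p ` B)"
        unfolding c(2) using c(1) by (intro fls.span_sum fls.span_scale fls.span_base) blast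
    qed
    ultimately show "inj_on p B \<and> fls.independent (p ` B) \<and> p ` V \<subseteq> fls.span (p ` B)"
      by blast
  next
    assume R: "inj_on p B \<and> fls.independent (p ` B) \<and> p ` V \<subseteq> fls.span (p ` B)"
    show "basis_modulo V W B"
      unfolding basis_iff
    proof (intro ballI ex_ex1I)
      fix v assume "v \<in> V"
      then have "p v \<in> p ` fls.span B"
        using R p.span_image[of B] by blast
      then obtain w where w: "w \<in> fls.span B" "p v = p w" by blast
      obtain T u where T: "finite T" "T \<subseteq> B" "w = (\<Sum>b\<in>T. fls_scale (u b) b)"
        using w(1) unfolding fls.span_explicit by blast
      define c where "c b = (if b \<in> T then u b else 0)" for b
      have supp: "{b. c b \<noteq> 0} \<subseteq> T" by (auto simp: c_def)
      have "p v = (\<Sum>b\<in>T. fls_scale (c b) (p b))"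
        by (simp add: w(2) T(3) p.sum p.scale c_def)
      then have "coords v c"
        unfolding coords_def sum_supp[OF T(1) supp] using supp T by (auto intro: finite_subset)
      then show "\<exists>c. coords v c" by blast
    next
      fix v c d assume "coords v c" "coords v d"
      note cd = this[unfolded coords_def]
      define T where "T = {b. c b \<noteq> 0} \<union> {b. d b \<noteq> 0}"
      have T: "finite T" "T \<subseteq> B" using cd by (auto simp: T_def)
      have injT: "inj_on p T" using R T(2) by (blast intro: inj_on_subset)
      have "(\<Sum>b\<in>T. fls_scale (c b) (p b)) = (\<Sum>b\<in>T. fls_scale (d b) (p b))"
        using cd sum_supp[OF T(1), of c] sum_supp[OF T(1), of d] by (auto simp: T_def)
      then have "(\<Sum>b\<in>T. fls_scale (c b - d b) (p b)) = 0"
        by (simp add: fls.scale_left_diff_distrib sum_subtractf)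
      then have sum0: "(\<Sum>y\<in>p ` T. fls_scale (c (inv_into T p y) - d (inv_into T p y)) y) = 0"
        by (simp add: sum.reindex[OF injT] inv_into_f_f[OF injT])
      have "c b = d b" if "b \<in> T" for b
        using fls.independentD[of "p ` B", OF _ _ _ sum0, of "p b"] R T that
        by (simp add: image_mono inv_into_f_f[OF injT])
      moreover have "c b = d b" if "b \<notin> T" for b
        using that by (simp add: T_def)
      ultimately show "c = d" by blast
    qed
  qed
qed

text \<open>
  The isomorphism \<open>V / W \<cong> p ` V\<close>. It makes the value independent of the basis that the choice
  operator picks, since all bases of \<open>p ` V\<close> have the same cardinality.
\<close>

lemma quotient_dim_eq_dim_image:
  fixes p :: "'k::field fls \<Rightarrow> 'k fls"
  assumes lin: "fls_linear p" and V: "fls.subspace V" and W: "W = {v \<in> V. p v = 0}"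
  shows "quotient_dim V W = fls.dim (p ` V)"
proof -
  interpret p: Vector_Spaces.linear fls_scale fls_scale p by (rule lin)
  obtain C where C: "C \<subseteq> p ` V" "fls.independent C" "p ` V \<subseteq> fls.span C"
    using fls.maximal_independent_subset by blast
  obtain B where B: "B \<subseteq> V" "C = p ` B" "inj_on p B"
    using C(1) by (meson subset_image_inj)
  have "basis_modulo V W B"
    using basis_modulo_kernel_iff[OF lin V W B(1)] B C by blast
  then have "basis_modulo V W (SOME B. basis_modulo V W B)" (is "basis_modulo V W ?B")
    by (rule someI)
  moreover from this have sub: "?B \<subseteq> V" by (simp add: basis_modulo_def)
  ultimately have "inj_on p ?B" "fls.independent (p ` ?B)" "p ` V \<subseteq> fls.span (p ` ?B)"
    using basis_modulo_kernel_iff[OF lin V W] by blast+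
  then show ?thesis
    using fls.basis_card_eq_dim[of "p ` ?B" "p ` V"] sub
    by (simp add: quotient_dim_def card_image image_mono)
qed

section \<open>Laurent series with prescribed support\<close>

text \<open>
  The semigroup ring, its maximal ideal, its conductor and the module \<open>(R : \<mm>)\<close> all have this form.
\<close>

definition supported_on :: "int set \<Rightarrow> 'k::field fls set" where
  "supported_on A = {f. \<forall>n. f $$ n \<noteq> 0 \<longrightarrow> n \<in> A}"

lemma supported_onI: "(\<And>n. n \<notin> A \<Longrightarrow> f $$ n = 0) \<Longrightarrow> f \<in> supported_on A"
  unfolding supported_on_def by blast

lemma supported_onD: "f \<in> supported_on A \<Longrightarrow> n \<notin> A \<Longrightarrow> f $$ n = 0"
  unfolding supported_on_def by blast

lemma subspace_supported_on: "fls.subspace (supported_on A)"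
  by (auto simp: fls.subspace_def supported_on_def; metis add.right_neutral)

lemma supported_on_mono: "A \<subseteq> B \<Longrightarrow> supported_on A \<subseteq> supported_on B"
  by (auto simp: supported_on_def)

lemma fls_times_nth_nonzeroE:
  fixes f g :: "'k::field fls"
  assumes "(f * g) $$ n \<noteq> 0"
  obtains i where "f $$ i \<noteq> 0" "g $$ (n - i) \<noteq> 0"
proof -
  obtain i where "f $$ i * g $$ (n - i) \<noteq> 0"
    using assms unfolding fls_times_nth(2)[of f g n] by (meson sum.neutral)
  then show ?thesis using that[of i] by simp
qed

lemma times_supported_on:
  assumes "f \<in> supported_on A" "g \<in> supported_on B" "\<And>a b. a \<in> A \<Longrightarrow> b \<in> B \<Longrightarrow> a + b \<in> C"
  shows "f * g \<in> supported_on C"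
proof (rule supported_onI, rule ccontr)
  fix n assume n: "n \<notin> C" "(f * g) $$ n \<noteq> 0"
  then obtain i where "f $$ i \<noteq> 0" "g $$ (n - i) \<noteq> 0"
    by (elim fls_times_nth_nonzeroE)
  then have "i + (n - i) \<in> C"
    using assms unfolding supported_on_def by blast
  with n show False by simp
qed

lemma fls_X_intpow_supported_on: "fls_X_intpow n \<in> supported_on A \<longleftrightarrow> n \<in> A"
  by (auto simp: supported_on_def)

lemma dim_supported_on:
  assumes "finite D"
  shows "fls.dim (supported_on D :: 'k::field fls set) = card D"
proof -
  let ?X = "fls_X_intpow :: int \<Rightarrow> 'k fls"
  have inj: "inj ?X"
    by (rule injI) (metis fls_subdegree_fls_X_intpow)
  have "fls.independent (?X ` D)"
    unfolding fls.independent_explicit_module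
  proof (intro allI impI)
    fix t u v
    assume t: "finite t" "t \<subseteq> ?X ` D" and s: "(\<Sum>v\<in>t. fls_scale (u v) v) = 0" and v: "v \<in> t"
    obtain i where i: "v = ?X i" using t v by auto
    have "w $$ i = (if w = v then 1 else 0)" if "w \<in> t" for w
      using t(2) that i by auto
    then have "(\<Sum>w\<in>t. u w * w $$ i) = (\<Sum>w\<in>t. if w = v then u w else 0)"
      by (intro sum.cong) auto
    also have "\<dots> = u v" using t v by simp
    finally show "u v = 0"
      using arg_cong[OF s, of "\<lambda>f. f $$ i"] by (simp add: fls_nth_sum)
  qed
  moreover have "supported_on D \<subseteq> fls.span (?X ` D)"
  proof
    fix f :: "'k fls" assume f: "f \<in> supported_on D"
    have "f = (\<Sum>i\<in>D. fls_scale (f $$ i) (?X i))"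
    proof (rule fls_eqI)
      fix n
      have "(\<Sum>i\<in>D. fls_scale (f $$ i) (?X i)) $$ n = (\<Sum>i\<in>D. if i = n then f $$ i else 0)"
        unfolding fls_nth_sum by (intro sum.cong) auto
      also have "\<dots> = f $$ n"
        using assms supported_onD[OF f] by simp
      finally show "f $$ n = (\<Sum>i\<in>D. fls_scale (f $$ i) (?X i)) $$ n" ..
    qed
    moreover have "\<dots> \<in> fls.span (?X ` D)"
      by (intro fls.span_sum fls.span_scale fls.span_base imageI)
    ultimately show "f \<in> fls.span (?X ` D)" by simp
  qed
  ultimately have "card (?X ` D) = fls.dim (supported_on D :: 'k fls set)"
    by (intro fls.basis_card_eq_dim) (auto simp: fls_X_intpow_supported_on)
  then show ?thesis
    using card_image[OF inj_on_subset[OF inj subset_UNIV]] by metis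
qed

text \<open>The projection of \<open>k((t))\<close> that keeps the terms with exponent in \<open>D\<close>.\<close>

definition fls_restrict :: "int set \<Rightarrow> 'k::field fls \<Rightarrow> 'k fls" where
  "fls_restrict D f = Abs_fls (\<lambda>n. if n \<in> D then f $$ n else 0)"

lemma fls_restrict_nth [simp]: "fls_restrict D f $$ n = (if n \<in> D then f $$ n else 0)"
proof -
  obtain N where "\<forall>n<N. f $$ n = 0" by (elim fls_nth_vanishes_belowE)
  then have "\<forall>n<N. (if n \<in> D then f $$ n else 0) = 0" by simp
  then show ?thesis unfolding fls_restrict_def by (rule nth_Abs_fls_lower_bound)
qed

text \<open>
  The factor \<open>u\<close> is an arbitrary nonzero series because the type is defined through an unspecified
  parameter of the ring. Divide by \<open>u\<close> and project to the exponents in \<open>D\<close>.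
\<close>

lemma quotient_dim_supported_on:
  fixes u :: "'k::field fls"
  assumes u: "u \<noteq> 0" and D: "finite D" "D \<subseteq> A"
  shows "quotient_dim ((*) u ` supported_on A) ((*) u ` supported_on (A - D)) = card D"
proof -
  define p where "p v = fls_restrict D (v / u)" for v
  have lin: "fls_linear p"
    by unfold_locales
      (auto simp: p_def add_divide_distrib fls_eq_iff times_divide_eq_right[symmetric]
        simp del: times_divide_eq_right)
  have pu: "p (u * w) = fls_restrict D w" for w
    using u by (simp add: p_def)
  have "Vector_Spaces.linear fls_scale fls_scale ((*) u)"
    by unfold_locales (simp_all add: algebra_simps)
  then interpret u: Vector_Spaces.linear fls_scale fls_scale "(*) u" .
  have V: "fls.subspace ((*) u ` supported_on A)"
    by (intro u.subspace_image subspace_supported_on)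
  have W: "(*) u ` supported_on (A - D) = {v \<in> (*) u ` supported_on A. p v = 0}"
  proof -
    have "w \<in> supported_on (A - D) \<longleftrightarrow> w \<in> supported_on A \<and> fls_restrict D w = 0" for w :: "'k fls"
      using D(2) by (auto simp: supported_on_def fls_eq_iff)
    then show ?thesis by (auto simp: pu)
  qed
  have "p ` (*) u ` supported_on A = supported_on D"
  proof
    show "p ` (*) u ` supported_on A \<subseteq> supported_on D"
      by (auto simp: pu intro!: supported_onI)
    have "w = p (u * w)" if "w \<in> supported_on D" for w
      using that by (auto simp: pu supported_on_def fls_eq_iff)
    then show "supported_on D \<subseteq> p ` (*) u ` supported_on A"
      using supported_on_mono[OF D(2)] by blast
  qed
  then show ?thesis
    by (simp add: quotient_dim_eq_dim_image[OF lin V W] dim_supported_on D)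
qed

section \<open>The semigroup ring as a ring of series with support in the semigroup\<close>

lemma int_image_iff: "n \<in> int ` S \<longleftrightarrow> 0 \<le> n \<and> nat n \<in> S"
  by (metis image_iff int_nat_eq nat_int of_nat_0_le_iff)

lemma numerical_semigroup_add: "numerical_semigroup S \<Longrightarrow> a \<in> S \<Longrightarrow> b \<in> S \<Longrightarrow> a + b \<in> S"
  by (simp add: numerical_semigroup_def)

lemma numerical_semigroup_0: "numerical_semigroup S \<Longrightarrow> 0 \<in> S"
  by (simp add: numerical_semigroup_def)

lemma numerical_semigroup_cofinite:
  assumes "numerical_semigroup S"
  obtains N where "\<And>n. n \<ge> N \<Longrightarrow> n \<in> S"
proof -
  have "finite (UNIV - S)" using assms by (simp add: numerical_semigroup_def)
  then obtain N where "\<forall>n\<in>UNIV - S. n < N" using finite_nat_set_iff_bounded by blast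
  then have "n \<in> S" if "n \<ge> N" for n using that by (meson DiffI UNIV_I not_le)
  then show ?thesis by (rule that)
qed

lemma multiplicity_sg_mem:
  assumes "numerical_semigroup S"
  shows "multiplicity_sg S \<in> S" "multiplicity_sg S \<noteq> 0"
proof -
  obtain N where N: "\<And>n. n \<ge> N \<Longrightarrow> n \<in> S" 
    using numerical_semigroup_cofinite[OF assms] by blast
  have "Suc N \<in> S \<and> Suc N \<noteq> 0" using N by simp
  then have "multiplicity_sg S \<in> S \<and> multiplicity_sg S \<noteq> 0"
    unfolding multiplicity_sg_def by (rule LeastI)
  then show "multiplicity_sg S \<in> S" "multiplicity_sg S \<noteq> 0" by auto
qed

text \<open>
  Beyond the cofinite tail shifted by \<open>m\<close>, every element splits off a summand \<open>m\<close>. Finiteness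
  matters because sums over infinite sets have the value zero.
\<close>

lemma finite_min_gens:
  assumes "numerical_semigroup S"
  shows "finite (min_gens S)"
proof -
  obtain N where N: "\<And>n. n \<ge> N \<Longrightarrow> n \<in> S" 
    using numerical_semigroup_cofinite[OF assms] by blast
  let ?m = "multiplicity_sg S"
  have "g \<le> N + ?m" if "g \<in> min_gens S" for g
  proof (rule ccontr)
    assume "\<not> g \<le> N + ?m"
    then have "g - ?m \<in> S - {0}" "?m \<in> S - {0}" "g = ?m + (g - ?m)"
      using N multiplicity_sg_mem[OF assms] by auto
    then show False
      using that unfolding min_gens_def by blast
  qed
  then show ?thesis by (meson finite_nat_set_iff_bounded_le)
qed

definition exponent_vectors :: "nat set \<Rightarrow> nat \<Rightarrow> (nat \<Rightarrow> nat) set" where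
  "exponent_vectors G n = {a. (\<forall>g. g \<notin> G \<longrightarrow> a g = 0) \<and> (\<Sum>g\<in>G. a g * g) = n}"

lemma finite_exponent_vectors:
  assumes "finite G" "0 \<notin> G"
  shows "finite (exponent_vectors G n)"
proof (rule finite_subset)
  show "exponent_vectors G n \<subseteq> {a. \<forall>g. (g \<in> G \<longrightarrow> a g \<in> {..n}) \<and> (g \<notin> G \<longrightarrow> a g = 0)}"
  proof clarify
    fix a g assume a: "a \<in> exponent_vectors G n"
    have "a g \<le> n" if g: "g \<in> G"
    proof -
      have "a g \<le> a g * g" using g assms(2) by (cases g) auto
      also have "\<dots> \<le> (\<Sum>g\<in>G. a g * g)" by (rule member_le_sum[OF g _ assms(1)]) simp
      finally show ?thesis using a by (simp add: exponent_vectors_def)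
    qed
    then show "(g \<in> G \<longrightarrow> a g \<in> {..n}) \<and> (g \<notin> G \<longrightarrow> a g = 0)"
      using a by (simp add: exponent_vectors_def)
  qed
  show "finite {a. \<forall>g. (g \<in> G \<longrightarrow> a g \<in> {..n}) \<and> (g \<notin> G \<longrightarrow> a g = 0)}"
    using assms(1) by (intro finite_set_of_finite_funs) auto
qed

lemma exponent_vectors_min_gens_nonempty:
  assumes S: "numerical_semigroup S" and "n \<in> S"
  shows "exponent_vectors (min_gens S) n \<noteq> {}"
  using \<open>n \<in> S\<close>
proof (induction n rule: less_induct)
  case (less n)
  note fin = finite_min_gens[OF S]
  consider "n = 0" | "n \<in> min_gens S"
    | a b where "a \<in> S - {0}" "b \<in> S - {0}" "n = a + b"
    using less.prems unfolding min_gens_def by blast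
  then show ?case
  proof cases
    case 1
    then have "(\<lambda>_. 0) \<in> exponent_vectors (min_gens S) n" by (simp add: exponent_vectors_def)
    then show ?thesis by blast
  next
    case 2
    have "(\<Sum>g\<in>min_gens S. (if g = n then 1 else 0) * g) = (\<Sum>g\<in>min_gens S. if g = n then g else 0)"
      by (intro sum.cong) auto
    also have "\<dots> = n" using fin 2 by simp
    finally have "(\<lambda>g. if g = n then 1 else 0) \<in> exponent_vectors (min_gens S) n"
      using 2 by (auto simp: exponent_vectors_def)
    then show ?thesis by blast
  next
    case 3
    then obtain x y where "x \<in> exponent_vectors (min_gens S) a" "y \<in> exponent_vectors (min_gens S) b"
      using less.IH[of a] less.IH[of b] by auto
    then have "(\<lambda>g. x g + y g) \<in> exponent_vectors (min_gens S) n"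
      using 3 by (auto simp: exponent_vectors_def add_mult_distrib sum.distrib)
    then show ?thesis by blast
  qed
qed

lemma weight_mem_semigroup:
  assumes S: "numerical_semigroup S" and "G \<subseteq> S"
  shows "(\<Sum>g\<in>G. a g * g) \<in> S"
proof -
  have "k * g \<in> S" if "g \<in> S" for k g
    by (induction k) (simp_all add: numerical_semigroup_0[OF S] numerical_semigroup_add[OF S] that)
  then show ?thesis
    using assms(2)
    by (induction G rule: infinite_finite_induct)
      (auto simp: numerical_semigroup_0[OF S] numerical_semigroup_add[OF S])
qed

text \<open>
  To hit a given series with support in \<open>S\<close>, pick one factorization of each \<open>n \<in> S\<close> into minimal
  generators, place the coefficient of \<open>t^n\<close> on it, and put zero on all the others.
\<close>

lemma semigroup_ring_eq_supported_on:
  assumes S: "numerical_semigroup S"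
  shows "(semigroup_ring S :: 'k::field fls set) = supported_on (int ` S)"
proof -
  let ?G = "min_gens S"
  have G: "?G \<subseteq> S" "0 \<notin> ?G" by (auto simp: min_gens_def)
  have nth: "fps_subst_powers ?G c $ n = sum c (exponent_vectors ?G n)" for c :: "_ \<Rightarrow> 'k" and n
    by (simp add: fps_subst_powers_def exponent_vectors_def)
  show ?thesis
  proof
    show "(semigroup_ring S :: 'k fls set) \<subseteq> supported_on (int ` S)"
    proof
      fix f :: "'k fls" assume "f \<in> semigroup_ring S"
      then obtain c where f: "f = fps_to_fls (fps_subst_powers ?G c)"
        by (auto simp: semigroup_ring_def)
      show "f \<in> supported_on (int ` S)"
      proof (rule supported_onI)
        fix n assume n: "n \<notin> int ` S"
        show "f $$ n = 0"
        proof (cases "n < 0")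
          case False
          then have "nat n \<notin> S" using n by (simp add: int_image_iff)
          have "a \<notin> exponent_vectors ?G (nat n)" for a
            using weight_mem_semigroup[OF S G(1), of a] \<open>nat n \<notin> S\<close>
            by (auto simp: exponent_vectors_def)
          then have "exponent_vectors ?G (nat n) = {}" by blast
          then show ?thesis by (simp add: f nth)
        qed (simp add: f)
      qed
    qed
    show "supported_on (int ` S) \<subseteq> (semigroup_ring S :: 'k fls set)"
    proof
      fix f :: "'k fls" assume f: "f \<in> supported_on (int ` S)"
      define pick where "pick n = (SOME a. a \<in> exponent_vectors ?G n)" for n
      have pick: "pick n \<in> exponent_vectors ?G n" if "n \<in> S" for n
        unfolding pick_def using exponent_vectors_min_gens_nonempty[OF S that]
        by (simp add: some_in_eq)
      define c where "c a = (let n = \<Sum>g\<in>?G. a g * g in if a = pick n then f $$ int n else 0)" for a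
      have "fps_subst_powers ?G c $ n = f $$ int n" for n
      proof -
        have "fps_subst_powers ?G c $ n =
            (\<Sum>a\<in>exponent_vectors ?G n. if a = pick n then f $$ int n else 0)"
          unfolding nth by (intro sum.cong) (auto simp: c_def exponent_vectors_def)
        also have "\<dots> = (if pick n \<in> exponent_vectors ?G n then f $$ int n else 0)"
          by (simp add: finite_exponent_vectors[OF finite_min_gens[OF S] G(2)])
        also have "\<dots> = f $$ int n"
          using pick[of n] supported_onD[OF f, of "int n"] by (cases "n \<in> S") (auto simp: int_image_iff)
        finally show ?thesis .
      qed
      moreover have "f $$ n = 0" if "n < 0" for n
        using that by (intro supported_onD[OF f]) (simp add: int_image_iff)
      ultimately have "fps_to_fls (fps_subst_powers ?G c) = f"
        by (intro fls_eqI) simp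
      then show "f \<in> semigroup_ring S"
        unfolding semigroup_ring_def by blast
    qed
  qed
qed

text \<open>
  If \<open>n\<close> is a gap, then of two exponents with sum \<open>n\<close> at least one is a gap. In the recursion for
  the coefficients of the inverse, this leaves only the term in which \<open>n\<close> itself is an exponent of
  the inverse.
\<close>

lemma inverse_supported_on_semigroup:
  fixes f :: "'k::field fls"
  assumes S: "numerical_semigroup S" and f: "f \<in> supported_on (int ` S)" "f $$ 0 \<noteq> 0"
  shows "inverse f \<in> supported_on (int ` S)"
proof -
  define g where "g = inverse f"
  have "f \<noteq> 0" using f(2) by auto
  then have fg: "f * g = 1" by (simp add: g_def)
  have f_neg: "f $$ n = 0" if "n < 0" for n
    using that by (intro supported_onD[OF f(1)]) auto
  have "fls_subdegree f = 0"
    using f(2) f_neg by (intro fls_subdegree_eqI) auto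
  then have g0: "fls_subdegree g = 0" by (simp add: g_def)
  have step: "g $$ int n = 0" if "n \<notin> S" for n
    using that
  proof (induction n rule: less_induct)
    case (less n)
    have "n \<noteq> 0" using less.prems numerical_semigroup_0[OF S] by metis
    have "f $$ i * g $$ (int n - i) = 0" if i: "i \<in> {0<..int n}" for i
    proof (rule ccontr)
      assume ne: "f $$ i * g $$ (int n - i) \<noteq> 0"
      then have "nat i \<in> S" using supported_onD[OF f(1), of i] by (auto simp: int_image_iff)
      moreover have "nat (int n - i) \<in> S"
      proof (rule ccontr)
        assume "nat (int n - i) \<notin> S"
        moreover have "nat (int n - i) < n" "int (nat (int n - i)) = int n - i" using i by auto
        ultimately show False using less.IH[of "nat (int n - i)"] ne by simp
      qed
      ultimately have "nat i + nat (int n - i) \<in> S" by (rule numerical_semigroup_add[OF S])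
      moreover have "nat i + nat (int n - i) = n" using i by (simp add: nat_eq_iff flip: nat_add_distrib)
      ultimately show False using less.prems by simp
    qed
    then have rest: "(\<Sum>i\<in>{0<..int n}. f $$ i * g $$ (int n - i)) = 0"
      by (intro sum.neutral) blast
    have "{0..int n} = insert 0 {0<..int n}" by auto
    then have "(f * g) $$ int n = f $$ 0 * g $$ int n"
      using rest by (simp add: fls_times_nth(2) \<open>fls_subdegree f = 0\<close> g0)
    then show ?case using fg \<open>n \<noteq> 0\<close> f(2) by simp
  qed
  show ?thesis
    unfolding g_def[symmetric]
  proof (rule supported_onI)
    fix n assume n: "n \<notin> int ` S"
    show "g $$ n = 0"
    proof (cases "n < 0")
      case True then show ?thesis using g0 by simp
    next
      case False
      then have "nat n \<notin> S" using n by (simp add: int_image_iff)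
      then show ?thesis using step[of "nat n"] False by simp
    qed
  qed
qed

text \<open>The units are the series of the ring with a nonzero constant term.\<close>

lemma maximal_ideal_of_supported_on:
  assumes S: "numerical_semigroup S"
  shows "maximal_ideal_of (supported_on (int ` S) :: 'k::field fls set) = supported_on (int ` (S - {0}))"
proof -
  have "(\<exists>g\<in>supported_on (int ` S). f * g = 1) \<longleftrightarrow> f $$ 0 \<noteq> 0"
    if f: "f \<in> supported_on (int ` S)" for f :: "'k fls"
  proof
    assume "\<exists>g\<in>supported_on (int ` S). f * g = 1"
    then obtain g where g: "g \<in> supported_on (int ` S)" "f * g = 1" by blast
    then have "(f * g) $$ 0 \<noteq> 0" by simp
    then obtain i where "f $$ i \<noteq> 0" "g $$ (0 - i) \<noteq> 0" by (rule fls_times_nth_nonzeroE)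
    moreover from this have "i \<ge> 0" "0 - i \<ge> 0"
      using supported_onD[OF f, of i] supported_onD[OF g(1), of "0 - i"] by force+
    ultimately show "f $$ 0 \<noteq> 0" by simp
  next
    assume "f $$ 0 \<noteq> 0"
    moreover from this have "f * inverse f = 1" by (metis fls_zero_nth right_inverse)
    ultimately show "\<exists>g\<in>supported_on (int ` S). f * g = 1"
      using inverse_supported_on_semigroup[OF S f] by blast
  qed
  moreover have "f \<in> supported_on (int ` (S - {0})) \<longleftrightarrow> f \<in> supported_on (int ` S) \<and> f $$ 0 = 0"
    for f :: "'k fls"
  proof -
    have "int ` (S - {0}) = int ` S - {0}" by auto
    then show ?thesis unfolding supported_on_def by auto
  qed
  ultimately show ?thesis
    unfolding maximal_ideal_of_def by blast
qed

section \<open>The type as a number of pseudo-Frobenius numbers\<close>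

text \<open>
  Integers rather than naturals, as in the definition of the colon module below: for
  \<open>S = \<nat>\<close> the only pseudo-Frobenius number is \<open>-1\<close>.
\<close>

definition pseudo_frobenius :: "nat set \<Rightarrow> int set" where
  "pseudo_frobenius S = {f. f \<notin> int ` S \<and> (\<forall>s\<in>S - {0}. f + int s \<in> int ` S)}"

lemma finite_pseudo_frobenius:
  assumes S: "numerical_semigroup S"
  shows "finite (pseudo_frobenius S)"
proof -
  obtain N where N: "\<And>n. n \<ge> N \<Longrightarrow> n \<in> S" 
    using numerical_semigroup_cofinite[OF S] by blast
  let ?m = "multiplicity_sg S"
  have "pseudo_frobenius S \<subseteq> {- int ?m..int N}"
  proof
    fix f assume f: "f \<in> pseudo_frobenius S"
    have "f + int ?m \<in> int ` S"
      using f multiplicity_sg_mem[OF S] by (simp add: pseudo_frobenius_def)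
    moreover have "f < int N"
    proof (rule ccontr)
      assume "\<not> f < int N"
      then have "f \<in> int ` S" using N by (simp add: int_image_iff)
      then show False using f by (simp add: pseudo_frobenius_def)
    qed
    ultimately show "f \<in> {- int ?m..int N}" by auto
  qed
  then show ?thesis by (rule finite_subset) simp
qed

text \<open>
  The colon module \<open>(R : \<mm>)\<close>. Multiplying by the monomials \<open>t^s\<close> of \<open>\<mm>\<close> tests one exponent
  of \<open>w\<close> at a time.
\<close>

lemma colon_maximal_ideal:
  fixes w :: "'k::field fls"
  assumes S: "numerical_semigroup S"
  shows "(\<forall>y\<in>supported_on (int ` (S - {0})). y * w \<in> supported_on (int ` S)) \<longleftrightarrow>
    w \<in> supported_on (int ` S \<union> pseudo_frobenius S)" (is "?L \<longleftrightarrow> ?R")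
proof
  assume L: ?L
  show ?R
  proof (rule supported_onI, rule ccontr)
    fix n assume n: "n \<notin> int ` S \<union> pseudo_frobenius S" "w $$ n \<noteq> 0"
    then have "\<not> (\<forall>s\<in>S - {0}. n + int s \<in> int ` S)"
      unfolding pseudo_frobenius_def mem_Collect_eq Un_iff by argo
    then obtain s where s: "s \<in> S - {0}" "n + int s \<notin> int ` S" by blast
    have "fls_X_intpow (int s) * w \<in> supported_on (int ` S)"
      using s(1) by (intro L[rule_format]) (simp add: fls_X_intpow_supported_on)
    then have "(fls_X_intpow (int s) * w) $$ (n + int s) = 0"
      using s(2) by (rule supported_onD)
    then show False using n by (simp add: fls_X_intpow_times_conv_shift)
  qed
next
  assume R: ?R
  show ?L
  proof
    fix y :: "'k fls" assume y: "y \<in> supported_on (int ` (S - {0}))"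
    show "y * w \<in> supported_on (int ` S)"
    proof (rule times_supported_on[OF y R])
      fix a b assume a: "a \<in> int ` (S - {0})" and b: "b \<in> int ` S \<union> pseudo_frobenius S"
      then obtain s where s: "a = int s" "s \<in> S - {0}" by blast
      show "a + b \<in> int ` S"
        using b
      proof
        assume "b \<in> int ` S"
        then obtain t where "b = int t" "t \<in> S" by blast
        then have "s + t \<in> S" "a + b = int (s + t)"
          using s numerical_semigroup_add[OF S] by auto
        then show ?thesis by (metis imageI)
      next
        assume "b \<in> pseudo_frobenius S"
        then show ?thesis using s by (simp add: pseudo_frobenius_def add.commute)
      qed
    qed
  qed
qed

text \<open>
  The preimage of the socle of \<open>R / x R\<close> is \<open>x (R : \<mm>)\<close> for every nonzero \<open>x \<in> \<mm>\<close>, because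
  \<open>x w \<in> R\<close> holds automatically when \<open>w \<in> (R : \<mm>)\<close>. Hence the socle is isomorphic to
  \<open>(R : \<mm>) / R\<close> whatever \<open>x\<close> is, and the pseudo-Frobenius numbers are the exponents of a
  monomial basis.
\<close>

lemma cm_type_semigroup_ring:
  assumes S: "numerical_semigroup S"
  shows "cm_type (semigroup_ring S :: 'k::field fls set) = card (pseudo_frobenius S)"
proof -
  let ?R = "supported_on (int ` S) :: 'k fls set"
  let ?M = "supported_on (int ` (S - {0})) :: 'k fls set"
  define x :: "'k fls" where "x = (SOME x. x \<in> ?M \<and> x \<noteq> 0)"
  have "fls_X_intpow (int (multiplicity_sg S)) \<in> ?M"
    using multiplicity_sg_mem[OF S] by (simp add: fls_X_intpow_supported_on)
  then have "\<exists>x. x \<in> ?M \<and> x \<noteq> 0" using fls_X_intpow_nonzero by blast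
  then have x: "x \<in> ?M" "x \<noteq> 0"
    unfolding x_def by (metis (mono_tags, lifting) someI_ex)+
  have princ: "principal_ideal ?R x = (*) x ` ?R"
    by (auto simp: principal_ideal_def)
  have socle: "socle_preimage ?R x = (*) x ` supported_on (int ` S \<union> pseudo_frobenius S)"
  proof (intro equalityI subsetI)
    fix z assume "z \<in> socle_preimage ?R x"
    then have z: "\<forall>y\<in>?M. y * z \<in> (*) x ` ?R"
      by (simp add: socle_preimage_def maximal_ideal_of_supported_on[OF S] princ)
    have "y * (z / x) \<in> ?R" if "y \<in> ?M" for y
    proof -
      have "y * z \<in> (*) x ` ?R" using z that by simp
      then obtain a where "a \<in> ?R" "y * z = x * a" by (rule imageE)
      then have "y * (z / x) = a" using x(2) by simp
      then show ?thesis using \<open>a \<in> ?R\<close> by simp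
    qed
    then have "z / x \<in> supported_on (int ` S \<union> pseudo_frobenius S)"
      using colon_maximal_ideal[OF S] by blast
    moreover have "z = x * (z / x)" using x(2) by simp
    ultimately show "z \<in> (*) x ` supported_on (int ` S \<union> pseudo_frobenius S)" by blast
  next
    fix z assume "z \<in> (*) x ` supported_on (int ` S \<union> pseudo_frobenius S)"
    then obtain w where w: "z = x * w" "w \<in> supported_on (int ` S \<union> pseudo_frobenius S)"
      by (rule imageE)
    then have yw: "y * w \<in> ?R" if "y \<in> ?M" for y
      using colon_maximal_ideal[OF S, of w] that by simp
    then have "y * z \<in> (*) x ` ?R" if "y \<in> ?M" for y
      using yw[OF that] by (auto simp: w(1) algebra_simps)
    then show "z \<in> socle_preimage ?R x"
      using yw[OF x(1)] w(1)
      by (simp add: socle_preimage_def maximal_ideal_of_supported_on[OF S] princ)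
  qed
  have "int ` S = int ` S \<union> pseudo_frobenius S - pseudo_frobenius S"
    by (auto simp: pseudo_frobenius_def)
  then have "quotient_dim (socle_preimage ?R x) (principal_ideal ?R x) = card (pseudo_frobenius S)"
    using quotient_dim_supported_on[OF x(2) finite_pseudo_frobenius[OF S], of "int ` S \<union> pseudo_frobenius S"]
    unfolding socle princ by simp
  then show ?thesis
    by (simp add: cm_type_def semigroup_ring_eq_supported_on[OF S] maximal_ideal_of_supported_on[OF S]
        Let_def flip: x_def)
qed

section \<open>The reduced type as a number of gaps\<close>

text \<open>
  Power series rings are integrally closed: if \<open>z\<close> had a pole, then \<open>1/z\<close> would be a power series,
  and the equation of degree \<open>d + 1\<close>, divided by \<open>z^d\<close>, would express \<open>z\<close> through power series.
\<close>

lemma integral_over_power_series: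
  fixes z :: "'k::field fls"
  assumes monic: "lead_coeff p = 1" and coeffs: "\<And>i. coeff p i \<in> supported_on {0..}"
    and root: "poly p z = 0"
  shows "z \<in> supported_on {0..}"
proof (rule ccontr)
  let ?O = "supported_on {0..} :: 'k fls set"
  have mult: "f * g \<in> ?O" if "f \<in> ?O" "g \<in> ?O" for f g
    using that by (rule times_supported_on) simp
  assume z: "z \<notin> ?O"
  then obtain n where "n < 0" "z $$ n \<noteq> 0" by (auto simp: supported_on_def not_le)
  then have "fls_subdegree z < 0" using fls_subdegree_leI[of z n] by simp
  then have w: "inverse z \<in> ?O"
    by (intro supported_onI) (simp add: fls_eq0_below_subdegree)
  have pow: "inverse z ^ j \<in> ?O" for j
  proof (induction j)
    case 0
    show ?case by (simp add: supported_on_def)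
  next
    case (Suc j)
    then show ?case using mult[OF w] by simp
  qed
  have "z \<noteq> 0" using \<open>z $$ n \<noteq> 0\<close> by auto
  obtain d where d: "degree p = Suc d"
  proof (cases "degree p")
    case 0
    then obtain a where "p = [:a:]" by (metis degree_eq_zeroE)
    then show ?thesis using monic root by simp
  qed
  have shift: "z ^ i * inverse z ^ d = inverse z ^ (d - i)" if "i \<le> d" for i
  proof -
    have "inverse z ^ d = inverse z ^ i * inverse z ^ (d - i)"
      using that by (simp flip: power_add)
    then show ?thesis using \<open>z \<noteq> 0\<close> by (simp add: power_inverse)
  qed
  have "0 = (\<Sum>i\<le>Suc d. coeff p i * z ^ i) * inverse z ^ d"
    using root by (simp add: poly_altdef d)
  also have "\<dots> = (\<Sum>i\<le>d. coeff p i * (z ^ i * inverse z ^ d)) + z * (z ^ d * inverse z ^ d)"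
    using monic d by (simp add: distrib_right sum_distrib_right mult.assoc)
  also have "\<dots> = (\<Sum>i\<le>d. coeff p i * inverse z ^ (d - i)) + z"
    using shift by simp
  finally have "z = - (\<Sum>i\<le>d. coeff p i * inverse z ^ (d - i))"
    by (simp add: eq_neg_iff_add_eq_0 add.commute)
  also have "\<dots> \<in> ?O"
    by (intro fls.subspace_neg[OF subspace_supported_on] fls.subspace_sum[OF subspace_supported_on]
        mult coeffs pow)
  finally show False using z by simp
qed

definition frobenius_number :: "nat set \<Rightarrow> nat" where
  "frobenius_number S = Max (UNIV - S)"

lemma frobenius_number:
  assumes "numerical_semigroup S" "S \<noteq> UNIV"
  shows "frobenius_number S \<notin> S" "frobenius_number S < n \<Longrightarrow> n \<in> S"
proof -
  have fin: "finite (UNIV - S)" and ne: "UNIV - S \<noteq> {}"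
    using assms by (auto simp: numerical_semigroup_def)
  show "frobenius_number S \<notin> S"
    using Max_in[OF fin ne] unfolding frobenius_number_def by blast
  show "n \<in> S" if "frobenius_number S < n"
  proof (rule ccontr)
    assume "n \<notin> S"
    then have "n \<le> frobenius_number S"
      unfolding frobenius_number_def by (intro Max_ge[OF fin]) simp
    with that show False by simp
  qed
qed

lemma fls_X_power_supported_on: "fls_X ^ n \<in> supported_on A \<longleftrightarrow> int n \<in> A"
  by (auto simp: supported_on_def)

text \<open>
  The integral closure lies between the monomials \<open>t^j\<close> and \<open>k[[t]]\<close>, and both bounds give the same
  conductor: if \<open>f\<close> has a nonzero coefficient at \<open>n \<le> F\<close>, then \<open>f t^(F-n)\<close> has one at
  the gap \<open>F\<close>. So the integral closure need not be computed.
\<close>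

lemma conductor_supported_on:
  assumes S: "numerical_semigroup S" "S \<noteq> UNIV"
  shows "conductor (supported_on (int ` S) :: 'k::field fls set) =
    supported_on {int (frobenius_number S)<..}"
proof -
  let ?R = "supported_on (int ` S) :: 'k fls set" and ?F = "frobenius_number S"
  let ?K = "quotient_field ?R"
  have one: "1 \<in> ?R"
    using numerical_semigroup_0[OF S(1)] by (intro supported_onI) auto
  have R_K: "f \<in> ?K" if "f \<in> ?R" for f
    unfolding quotient_field_def using that one by (intro CollectI exI[of _ f] exI[of _ 1]) simp
  have tail: "supported_on {int ?F<..} \<subseteq> ?R"
    using frobenius_number(2)[OF S] by (intro supported_on_mono) (auto simp: int_image_iff)
  have integral: "fls_X ^ j \<in> integral_closure ?R ?K" for j
  proof -
    let ?m = "multiplicity_sg S"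
    \<comment> \<open>\<open>t^j\<close> is a root of \<open>Y^m - t^(m j)\<close>, where \<open>m j \<in> S\<close>.\<close>
    let ?p = "pCons (- (fls_X ^ (?m * j))) (monom 1 (?m - 1)) :: 'k fls poly"
    have m: "?m \<in> S" "?m \<noteq> 0" using multiplicity_sg_mem[OF S(1)] .
    have "fls_X ^ j = (fls_X ^ (j + Suc ?F) / fls_X ^ Suc ?F :: 'k fls)"
      unfolding power_add by (rule nonzero_mult_div_cancel_right[symmetric]) (simp only: power_not_zero fls_X_nonzero not_False_eq_True)
    moreover have "fls_X ^ (j + Suc ?F) \<in> ?R" "fls_X ^ Suc ?F \<in> ?R"
      unfolding fls_X_power_supported_on using frobenius_number(2)[OF S]
      by (auto intro!: imageI simp del: of_nat_add of_nat_Suc add_Suc_right)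
    moreover have "fls_X ^ Suc ?F \<noteq> (0 :: 'k fls)"
      by (simp only: power_not_zero fls_X_nonzero not_False_eq_True)
    ultimately have K: "fls_X ^ j \<in> ?K"
      unfolding quotient_field_def by (intro CollectI exI conjI)
    have "?m * j \<in> S"
    proof (induction j)
      case 0
      show ?case using numerical_semigroup_0[OF S(1)] by simp
    next
      case (Suc j)
      then show ?case using numerical_semigroup_add[OF S(1) m(1)] by simp
    qed
    then have "- (fls_X ^ (?m * j)) \<in> ?R"
      by (intro fls.subspace_neg[OF subspace_supported_on])
        (simp only: fls_X_power_supported_on imageI)
    then have "coeff ?p i \<in> ?R" for i
      using one fls.subspace_0[OF subspace_supported_on, of "int ` S"]
      by (cases i) auto
    moreover have "lead_coeff ?p = 1"
      by (simp add: monom_eq_0_iff degree_monom_eq)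
    moreover have "poly ?p (fls_X ^ j) = 0"
    proof -
      have "fls_X ^ j * (fls_X ^ j) ^ (?m - 1) = ((fls_X ^ j) ^ ?m :: 'k fls)"
        using m(2) by (simp flip: power_Suc)
      then show ?thesis by (simp add: poly_monom mult.commute flip: power_mult)
    qed
    ultimately show ?thesis using K unfolding integral_closure_def by blast
  qed
  show ?thesis
  proof (intro equalityI subsetI)
    fix f assume "f \<in> conductor ?R"
    then have f: "f * y \<in> ?R" if "y \<in> integral_closure ?R ?K" for y
      using that by (simp add: conductor_def Let_def)
    show "f \<in> supported_on {int ?F<..}"
    proof (rule supported_onI)
      fix n assume "n \<notin> {int ?F<..}"
      then have n: "int ?F = n + int (nat (int ?F - n))" by simp
      have "(f * fls_X ^ nat (int ?F - n)) $$ int ?F = 0"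
        using frobenius_number(1)[OF S]
        by (intro supported_onD[OF f[OF integral]]) (simp add: int_image_iff)
      then show "f $$ n = 0"
        using n by (simp add: fls_X_power_times_conv_shift(2))
    qed
  next
    fix f :: "'k fls" assume f: "f \<in> supported_on {int ?F<..}"
    have "f * y \<in> ?R" if y: "y \<in> integral_closure ?R ?K" for y
    proof -
      have sub: "?R \<subseteq> supported_on {0..}" by (intro supported_on_mono) auto
      obtain p where p: "lead_coeff p = 1" "\<forall>i. coeff p i \<in> ?R" "poly p y = 0"
        using y unfolding integral_closure_def mem_Collect_eq by blast
      have "coeff p i \<in> supported_on {0..}" for i
        using p(2) sub by blast
      then have "y \<in> supported_on {0..}"
        by (rule integral_over_power_series[OF p(1) _ p(3)])
      with f have "f * y \<in> supported_on {int ?F<..}" by (rule times_supported_on) simp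
      then show ?thesis using tail by blast
    qed
    moreover have "f \<in> ?K" using f tail R_K by blast
    ultimately show "f \<in> conductor ?R"
      by (simp add: conductor_def Let_def)
  qed
qed

lemma principal_ideal_X_power:
  "principal_ideal (supported_on A :: 'k::field fls set) (fls_X ^ m) =
    supported_on ((\<lambda>n. n + int m) ` A)"
proof (intro equalityI subsetI)
  fix f :: "'k fls" assume "f \<in> principal_ideal (supported_on A) (fls_X ^ m)"
  then obtain a where "f = fls_X ^ m * a" "a \<in> supported_on A"
    by (auto simp: principal_ideal_def)
  moreover have "n - int m \<notin> A" if "n \<notin> (\<lambda>n. n + int m) ` A" for n
    using that by force
  ultimately show "f \<in> supported_on ((\<lambda>n. n + int m) ` A)"
    by (auto intro!: supported_onI simp: fls_X_power_times_conv_shift supported_onD)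
next
  fix f :: "'k fls" assume f: "f \<in> supported_on ((\<lambda>n. n + int m) ` A)"
  have "f = fls_X ^ m * fls_shift (int m) f"
    by (simp add: fls_X_power_times_conv_shift)
  moreover have "fls_shift (int m) f \<in> supported_on A"
  proof (rule supported_onI)
    fix n assume "n \<notin> A"
    then have "n + int m \<notin> (\<lambda>n. n + int m) ` A" by auto
    then show "fls_shift (int m) f $$ n = 0" using supported_onD[OF f] by simp
  qed
  ultimately show "f \<in> principal_ideal (supported_on A) (fls_X ^ m)"
    unfolding principal_ideal_def by blast
qed

lemma sum_supported_on:
  "{c + y | c y. c \<in> supported_on A \<and> y \<in> supported_on B} = (supported_on (A \<union> B) :: 'k::field fls set)"
proof (intro equalityI subsetI)
  fix f :: "'k fls" assume f: "f \<in> supported_on (A \<union> B)"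
  have "f = fls_restrict A f + fls_restrict (- A) f" by (rule fls_eqI) simp
  moreover have "fls_restrict A f \<in> supported_on A" by (rule supported_onI) simp
  moreover have "fls_restrict (- A) f \<in> supported_on B"
    using supported_onD[OF f] by (intro supported_onI) simp
  ultimately show "f \<in> {c + y | c y. c \<in> supported_on A \<and> y \<in> supported_on B}" by blast
next
  fix f :: "'k fls" assume "f \<in> {c + y | c y. c \<in> supported_on A \<and> y \<in> supported_on B}"
  then obtain c y where "f = c + y" "c \<in> supported_on A" "y \<in> supported_on B" by blast
  then show "f \<in> supported_on (A \<union> B)"
    using supported_on_mono[of A "A \<union> B"] supported_on_mono[of B "A \<union> B"]
    by (auto intro!: fls.subspace_add[OF subspace_supported_on])
qed

text \<open>
  The exponents of \<open>C + x R\<close> missing from \<open>x R\<close> are those beyond \<open>F\<close> outside \<open>m + S\<close>;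
  subtracting \<open>m\<close> from them gives the gaps in the last window of length \<open>m\<close>.
\<close>

lemma reduced_type_eq_card_gaps:
  assumes S: "numerical_semigroup S" "S \<noteq> UNIV"
  shows "reduced_type TYPE('k::field) S =
    card {n. n \<notin> S \<and> frobenius_number S < n + multiplicity_sg S}"
proof -
  let ?m = "multiplicity_sg S" and ?F = "frobenius_number S"
  let ?A = "{int ?F<..} \<union> (\<lambda>n. n + int ?m) ` int ` S"
  define gaps where "gaps = {n. n \<notin> S \<and> ?F < n + ?m}"
  let ?D = "(\<lambda>n. int (n + ?m)) ` gaps"
  have "finite (UNIV - S)" using S by (simp add: numerical_semigroup_def)
  then have fin: "finite gaps" by (rule rev_finite_subset) (auto simp: gaps_def)
  have "?m \<le> Suc ?F"
    unfolding multiplicity_sg_def using frobenius_number(2)[OF S] by (intro Least_le) simp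
  then have A: "?A - ?D = (\<lambda>n. n + int ?m) ` int ` S"
  proof (intro equalityI subsetI)
    fix n assume n: "n \<in> ?A - ?D"
    show "n \<in> (\<lambda>n. n + int ?m) ` int ` S"
    proof (rule ccontr)
      assume not: "n \<notin> (\<lambda>n. n + int ?m) ` int ` S"
      then have "int ?F < n" using n by blast
      then have nn: "n = int (nat (n - int ?m) + ?m)" using \<open>?m \<le> Suc ?F\<close> by simp
      then have "nat (n - int ?m) \<notin> S" using not by (metis imageI of_nat_add)
      moreover have "?F < nat (n - int ?m) + ?m" using nn \<open>int ?F < n\<close> by linarith
      ultimately have "n \<in> ?D" using nn unfolding gaps_def by blast
      then show False using n by blast
    qed
  qed (auto simp: gaps_def)
  have "quotient_dim (supported_on ?A :: 'k fls set) (supported_on (?A - ?D)) = card ?D"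
  proof -
    have id: "(*) (1 :: 'k fls) = (\<lambda>f. f)" by (rule ext) simp
    have "?D \<subseteq> ?A" by (auto simp: gaps_def)
    then show ?thesis
      using quotient_dim_supported_on[of "1 :: 'k fls" ?D ?A] fin unfolding id by simp
  qed
  also have "card ?D = card gaps"
    by (rule card_image) (simp add: inj_on_def)
  finally show ?thesis
    unfolding A
    by (simp add: reduced_type_def Let_def semigroup_ring_eq_supported_on[OF S(1)]
        conductor_supported_on[OF S] principal_ideal_X_power sum_supported_on flip: gaps_def)
qed

section \<open>A family with prescribed type\<close>

text \<open>
  With \<open>m = r + 1\<close> and \<open>m\<close> dividing \<open>c\<close>, this is the semigroup generated by \<open>m\<close>, by
  \<open>c + m + 1, \<dots>, c + m + r - 1\<close>, and by \<open>c + 2 m + r\<close>. All generators except \<open>m\<close> are maximal in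
  the Apery set of \<open>m\<close>, which gives the type \<open>r\<close>; raising the last one by \<open>m\<close> leaves its gap
  \<open>c + m + r\<close> alone in the last window.
\<close>

definition multiples_with_tail :: "nat \<Rightarrow> nat \<Rightarrow> nat set" where
  "multiples_with_tail r c = {n. Suc r dvd n \<or> c + Suc r < n \<and> n \<noteq> c + Suc r + r}"

context
  fixes r c :: nat
  assumes r: "r > 0" and c: "Suc r dvd c" "c > 0"
begin

private abbreviation "S \<equiv> multiples_with_tail r c"
private abbreviation "F \<equiv> c + Suc r + r"

private lemma mem_S: "n \<in> S \<longleftrightarrow> Suc r dvd n \<or> c + Suc r < n \<and> n \<noteq> F"
  by (simp add: multiples_with_tail_def)

private lemma between_multiples:
  assumes "Suc r dvd q" "q < n" "n < q + Suc r"
  shows "\<not> Suc r dvd n"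
proof
  assume "Suc r dvd n"
  then have "Suc r dvd n - q" using assms(1) by (rule dvd_diff_nat)
  moreover have "0 < n - q" "n - q < Suc r" using assms by auto
  ultimately show False by (meson nat_dvd_not_less)
qed

private lemma next_multiple: "Suc r dvd c + Suc r"
  using c(1) by (intro dvd_add dvd_refl)

private lemma F_notin: "F \<notin> S"
  using r between_multiples[OF next_multiple, of F] by (simp only: mem_S) simp

private lemma S_ge: "n \<in> S \<Longrightarrow> n \<noteq> 0 \<Longrightarrow> Suc r \<le> n"
  by (auto simp: mem_S dest: dvd_imp_le)

lemma numerical_semigroup_multiples_with_tail: "numerical_semigroup S"
proof -
  have "a + b \<in> S" if "a \<in> S" "b \<in> S" "c + Suc r < a" for a b
    using that S_ge[of b] by (cases "b = 0") (auto simp: mem_S)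
  then have "a + b \<in> S" if "a \<in> S" "b \<in> S" for a b
    using that by (metis add.commute dvd_add mem_S)
  moreover have "UNIV - S \<subseteq> {..F}" by (auto simp: mem_S)
  ultimately show ?thesis
    by (auto simp: numerical_semigroup_def mem_S intro: finite_subset)
qed

lemma multiplicity_multiples_with_tail: "multiplicity_sg S = Suc r"
  unfolding multiplicity_sg_def by (rule Least_equality) (auto simp: mem_S S_ge)

lemma frobenius_number_multiples_with_tail: "frobenius_number S = F"
  unfolding frobenius_number_def
proof (rule Max_eqI)
  show "finite (UNIV - S)"
    using numerical_semigroup_multiples_with_tail by (simp add: numerical_semigroup_def)
  show "F \<in> UNIV - S" using F_notin by simp
  show "n \<le> F" if "n \<in> UNIV - S" for n using that by (auto simp: mem_S)
qed

lemma reduced_type_multiples_with_tail: "reduced_type TYPE('k::field) S = 1"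
proof -
  have "n = F" if "n \<notin> S" "F < n + Suc r" for n
  proof -
    have "n \<ge> c + Suc r" using that(2) by simp
    moreover have "n \<noteq> c + Suc r" using that(1) next_multiple mem_S by blast
    ultimately show ?thesis using that(1) by (auto simp: mem_S)
  qed
  moreover have "F < F + Suc r" by simp
  ultimately have gaps: "{n. n \<notin> S \<and> F < n + Suc r} = {F}"
    using F_notin by blast
  have "S \<noteq> UNIV" using F_notin by blast
  then show ?thesis
    by (simp only: reduced_type_eq_card_gaps[OF numerical_semigroup_multiples_with_tail]
        frobenius_number_multiples_with_tail multiplicity_multiples_with_tail gaps
        not_False_eq_True) simp
qed

text \<open>
  Adding \<open>m\<close> moves the gaps between \<open>c\<close> and \<open>c + r\<close> into the first block of the tail, and every other
  nonzero element of \<open>S\<close> is at least \<open>2 m\<close> and moves them beyond \<open>F\<close>. The latter uses \<open>c > 0\<close>: for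
  \<open>c = 0\<close> the tail would begin below \<open>2 m\<close>, and its elements could move these gaps to \<open>F\<close>.
\<close>

lemma pseudo_frobenius_multiples_with_tail:
  "pseudo_frobenius S = int ` insert F {c<..<c + r}" (is "_ = int ` ?P")
proof (intro equalityI subsetI)
  fix f assume f: "f \<in> pseudo_frobenius S"
  then have f_notin: "f \<notin> int ` S" by (simp add: pseudo_frobenius_def)
  have plus: "f + int s \<in> int ` S" if "s \<in> S" "s \<noteq> 0" for s
    using f that by (simp add: pseudo_frobenius_def)
  have m: "Suc r \<in> S" by (simp add: mem_S)
  have fm: "f + int (Suc r) \<in> int ` S" using plus[OF m] by simp
  have "f \<ge> 0"
  proof (rule ccontr)
    assume neg: "\<not> f \<ge> 0"
    \<comment> \<open>A negative \<open>f\<close> would be moved to the gap \<open>F\<close> by an element beyond \<open>F\<close>.\<close>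
    define s where "s = nat (int F - f)"
    have s: "int s = int F - f" using neg by (simp add: s_def)
    then have "s > F" using neg by linarith
    then have "s \<in> S" "s \<noteq> 0" by (auto simp: mem_S)
    then have "int F \<in> int ` S" using plus[of s] s by simp
    then show False using F_notin by (simp only: int_image_iff nat_int) simp
  qed
  then obtain n where n: "f = int n" by (rule nonneg_int_cases)
  have "n \<notin> S" using f_notin n by blast
  moreover have "n + Suc r \<in> S"
  proof -
    have "int (n + Suc r) \<in> int ` S" using fm unfolding n of_nat_add .
    then show ?thesis by (simp only: int_image_iff nat_int)
  qed
  moreover have "Suc r dvd n + Suc r \<longleftrightarrow> Suc r dvd n" by (rule dvd_add_triv_right_iff)
  ultimately have "\<not> Suc r dvd n" "c < n" "n \<noteq> c + r" "n \<le> c + Suc r \<or> n = F"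
    by (auto simp: mem_S)
  moreover have "n \<noteq> c + Suc r" using calculation(1) next_multiple by blast
  ultimately have "n \<in> ?P" by auto
  then show "f \<in> int ` ?P" using n by blast
next
  fix f assume "f \<in> int ` ?P"
  then obtain n where n: "f = int n" "n \<in> ?P" by blast
  have "n \<notin> S"
    using n(2) F_notin between_multiples[OF c(1), of n] by (auto simp: mem_S)
  moreover have "n + s \<in> S" if s: "s \<in> S" "s \<noteq> 0" for s
  proof (cases "n = F \<or> s = Suc r")
    case True
    then show ?thesis using n(2) S_ge[OF s] by (auto simp: mem_S)
  next
    case False
    then have cn: "c < n" using n(2) by auto
    have "s \<ge> Suc r + Suc r"
    proof (cases "Suc r dvd s")
      case True
      then show ?thesis
        using between_multiples[of "Suc r" s] S_ge[OF s] False by (meson dvd_refl le_neq_implies_less not_le)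
    next
      case False
      then have "c + Suc r < s" using s by (simp add: mem_S)
      then show ?thesis using dvd_imp_le[OF c] by simp
    qed
    then show ?thesis using cn by (auto simp: mem_S)
  qed
  ultimately show "f \<in> pseudo_frobenius S"
    unfolding pseudo_frobenius_def n(1) by (auto simp: int_image_iff nat_add_distrib)
qed

lemma card_pseudo_frobenius_multiples_with_tail: "card (pseudo_frobenius S) = r"
  using r unfolding pseudo_frobenius_multiples_with_tail
  by (subst card_image) auto

end

theorem mainTheorem11:
  fixes r :: nat
  assumes "r > 0"
  shows "infinite {S. numerical_semigroup S \<and>
           cm_type (semigroup_ring S :: 'k::{alg_closed_field, field_char_0} fls set) = r \<and>
           minimal_reduced_type TYPE('k) S}"
proof -
  define T where "T k = multiples_with_tail r (Suc k * Suc r)" for k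
  have c: "Suc r dvd Suc k * Suc r" "0 < Suc k * Suc r" for k
    by (rule dvd_triv_right) simp
  have "inj T"
  proof (rule injI)
    fix i j assume "T i = T j"
    then have "frobenius_number (T i) = frobenius_number (T j)" by simp
    then have "Suc i * Suc r = Suc j * Suc r"
      unfolding T_def frobenius_number_multiples_with_tail[OF assms c] by linarith
    then show "i = j" by (metis mult_right_cancel nat.distinct(1) nat.inject)
  qed
  then have "infinite (range T)" by (rule range_inj_infinite)
  moreover have "range T \<subseteq> {S. numerical_semigroup S \<and>
      cm_type (semigroup_ring S :: 'k fls set) = r \<and> minimal_reduced_type TYPE('k) S}"
    using numerical_semigroup_multiples_with_tail[OF assms c]
      reduced_type_multiples_with_tail[OF assms c]
      card_pseudo_frobenius_multiples_with_tail[OF assms c]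
    by (auto simp: T_def minimal_reduced_type_def cm_type_semigroup_ring simp del: mult_Suc mult_Suc_right)
  ultimately show ?thesis using infinite_super by blast
qed

end
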